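(* Consider a sequence of connected graphs $G=G_N$ with $n=n_N\ge 2$ vertices and $m=m_N$ edges, each recursively coarsened into layers $H^{(1)},\dots,H^{(Z)}$ (with $Z=Z_N\ge1$) of a hierarchical support graph, and let $i=i_N$ be any choice of level with $1\le i\le Z$. Suppose that the coarsening method preserves the average node degree of horizontal and vertical edges, i.e. $D(i)=\Theta\!\left(\frac{m+n}{n}\right)$. Then $$r(i)=\Omega\!\left(\frac{n}{m}\right)\qquad\text{and}\qquad C(i)=\Theta(R(i)),$$ where in the regime $r(i)=\Theta\!\left(\frac nm\right)$ the second condition is relaxed to $C(i)=\mathcal{O}(R(i))$. That is: $r(i)=\Omega(n/m)$ always holds; if $r(i)=\omega(n/m)$ then $C(i)=\Theta(R(i))$; and if $r(i)=\Theta(n/m)$ then $C(i)=\mathcal{O}(R(i))$. (All asymptotics are along the sequence, $N\to\infty$.)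
   Context: All graphs are finite, simple and undirected. One coarsening step takes a graph $F$ and a partition $\{K_1,\dots,K_q\}$ of $V(F)$ into nonempty clusters, and produces the graph with one node $v_j$ per cluster $K_j$ and an edge $\{v_j,v_k\}$ ($j\ne k$) if and only if $F$ has at least one edge between $K_j$ and $K_k$. Recursive coarsening: $H^{(0)}=G$ and, for $1\le i\le Z$, $H^{(i)}$ is obtained from $H^{(i-1)}$ by one coarsening step (the node sets of different layers are taken to be disjoint). Edges of the $H^{(i)}$ are called horizontal. In addition every node $v$ of $H^{(i-1)}$, $1\le i\le Z$, is joined by a vertical edge to its super-node in $H^{(i)}$, i.e. the node representing the cluster containing $v$. Node and edge reduction factors: $r(i)=\frac{|V(H^{(i)})|}{|V(H^{(i-1)})|}$ and $c(i)=\frac{|E(H^{(i)})|}{|E(H^{(i-1)})|}$. Cumulative reductions: $R(i)=\prod_{j\le i}r(j)=|V(H^{(i)})|/n$ and $C(i)=\prod_{j\le i}c(j)=|E(H^{(i)})|/m$ (with $C(i)$ understood as $|E(H^{(i)})|/m$ if some factor is undefined), so that layer $i$ has $R(i)n$ nodes and $C(i)m$ edges. Average node degree of horizontal and vertical edges (up to constant factors, measured as edges per node): for the original graph, which has $m$ horizontal edges and $n$ vertical edges, it is $\frac{m+n}{n}$. For layer $i\ge1$ it is $$D(i)=\frac{|E(H^{(i)})| + |V(H^{(i-1)})| + u_i}{|V(H^{(i)})|},$$ where $|V(H^{(i-1)})|$ counts the vertical edges to the layer below and $u_i$ counts those to the layer above ($u_i=|V(H^{(i)})|$ if $i<Z$,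 and $u_i=0$ if $i=Z$). *)

theory Defs
  imports Complex_Main "HOL-Library.Disjoint_Sets" "HOL-Library.Landau_Symbols"
begin

record 'a ugraph =
  verts :: "'a set"
  edges :: "'a set set"

definition simple_graph :: "'a ugraph \<Rightarrow> bool" where
  "simple_graph F \<longleftrightarrow> finite (verts F) \<and>
     (\<forall>e\<in>edges F. \<exists>u\<in>verts F. \<exists>v\<in>verts F. u \<noteq> v \<and> e = {u, v})"

definition connected_graph :: "'a ugraph \<Rightarrow> bool" where
  "connected_graph F \<longleftrightarrow> verts F \<noteq> {} \<and>
     (\<forall>u\<in>verts F. \<forall>v\<in>verts F. (u, v) \<in> {(x, y). {x, y} \<in> edges F}\<^sup>*)"

abbreviation num_verts :: "'a ugraph \<Rightarrow> nat" where
  "num_verts F \<equiv> card (verts F)"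

abbreviation num_edges :: "'a ugraph \<Rightarrow> nat" where
  "num_edges F \<equiv> card (edges F)"

text \<open>The clusters form the partition \<open>P\<close>, and \<open>\<nu> K\<close> is the name of the node that represents
  the cluster \<open>K\<close>.\<close>

definition coarsening_step ::
  "'a ugraph \<Rightarrow> 'a set set \<Rightarrow> ('a set \<Rightarrow> 'a) \<Rightarrow> 'a ugraph \<Rightarrow> bool" where
  "coarsening_step F P \<nu> F' \<longleftrightarrow>
     partition_on (verts F) P \<and> inj_on \<nu> P \<and>
     verts F' = \<nu> ` P \<and>
     edges F' = {{\<nu> K, \<nu> L} | K L. K \<in> P \<and> L \<in> P \<and> K \<noteq> L \<and>
                                  (\<exists>x\<in>K. \<exists>y\<in>L. {x, y} \<in> edges F)}"

text \<open>The fields \<open>clusters i\<close> and \<open>cluster_node i\<close> describe the step that leads from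
  layer \<open>i - 1\<close> to layer \<open>i\<close>; they are relevant only for \<open>1 \<le> i \<le> depth\<close>.\<close>

record 'a hierarchy =
  depth :: nat
  layer :: "nat \<Rightarrow> 'a ugraph"
  clusters :: "nat \<Rightarrow> 'a set set"
  cluster_node :: "nat \<Rightarrow> 'a set \<Rightarrow> 'a"

definition recursive_coarsening :: "'a ugraph \<Rightarrow> 'a hierarchy \<Rightarrow> bool" where
  "recursive_coarsening G S \<longleftrightarrow>
     layer S 0 = G \<and>
     (\<forall>i\<in>{1..depth S}.
        coarsening_step (layer S (i - 1)) (clusters S i) (cluster_node S i) (layer S i)) \<and>
     (\<forall>i\<le>depth S. \<forall>j\<le>depth S. i \<noteq> j \<longrightarrow> verts (layer S i) \<inter> verts (layer S j) = {})"

definition super_node :: "'a hierarchy \<Rightarrow> nat \<Rightarrow> 'a \<Rightarrow> 'a" where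
  "super_node S i v = cluster_node S i (THE K. K \<in> clusters S i \<and> v \<in> K)"

text \<open>The vertical edges between layers \<open>i - 1\<close> and \<open>i\<close>.\<close>

definition vertical_edges :: "'a hierarchy \<Rightarrow> nat \<Rightarrow> 'a set set" where
  "vertical_edges S i = {{v, super_node S i v} | v. v \<in> verts (layer S (i - 1))}"

definition node_reduction :: "'a hierarchy \<Rightarrow> nat \<Rightarrow> real" where
  "node_reduction S i = real (num_verts (layer S i)) / real (num_verts (layer S (i - 1)))"

definition edge_reduction :: "'a hierarchy \<Rightarrow> nat \<Rightarrow> real" where
  "edge_reduction S i = real (num_edges (layer S i)) / real (num_edges (layer S (i - 1)))"

definition cum_node_reduction :: "'a hierarchy \<Rightarrow> nat \<Rightarrow> real" where
  "cum_node_reduction S i = (\<Prod>j=1..i. node_reduction S j)"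

text \<open>A factor is undefined when its denominator, the number of edges of the layer below,
  vanishes.\<close>

definition cum_edge_reduction :: "'a hierarchy \<Rightarrow> nat \<Rightarrow> real" where
  "cum_edge_reduction S i =
     (if \<forall>j\<in>{1..i}. num_edges (layer S (j - 1)) \<noteq> 0
      then \<Prod>j=1..i. edge_reduction S j
      else real (num_edges (layer S i)) / real (num_edges (layer S 0)))"

definition edges_above :: "'a hierarchy \<Rightarrow> nat \<Rightarrow> nat" where
  "edges_above S i = (if i < depth S then num_verts (layer S i) else 0)"

text \<open>For layers \<open>i \<ge> 1\<close>.  The lemma \<open>card_vertical_edges\<close> below justifies the two vertical terms.\<close>

definition avg_degree :: "'a hierarchy \<Rightarrow> nat \<Rightarrow> real" where
  "avg_degree S i =
     (real (num_edges (layer S i)) + real (num_verts (layer S (i - 1))) + real (edges_above S i))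
     / real (num_verts (layer S i))"

lemma coarsening_step_layer:
  assumes "recursive_coarsening G S" "1 \<le> i" "i \<le> depth S"
  shows "coarsening_step (layer S (i - 1)) (clusters S i) (cluster_node S i) (layer S i)"
  using assms by (simp add: recursive_coarsening_def)

lemma super_node_in_layer:
  assumes S: "recursive_coarsening G S" and i: "1 \<le> i" "i \<le> depth S"
    and v: "v \<in> verts (layer S (i - 1))"
  shows "super_node S i v \<in> verts (layer S i)"
proof -
  note coarsening_step_layer[OF S i]
  then have P: "partition_on (verts (layer S (i - 1))) (clusters S i)"
    and V: "verts (layer S i) = cluster_node S i ` clusters S i"
    by (auto simp: coarsening_step_def)
  obtain K where K: "K \<in> clusters S i" "v \<in> K"
    using P v by (auto simp: partition_on_def)
  have "(THE K. K \<in> clusters S i \<and> v \<in> K) = K"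
    using K P by (intro the_equality) (auto simp: partition_on_def disjoint_def)
  with K V show ?thesis by (simp add: super_node_def)
qed

lemma card_vertical_edges:
  assumes S: "recursive_coarsening G S" and i: "1 \<le> i" "i \<le> depth S"
  shows "card (vertical_edges S i) = num_verts (layer S (i - 1))"
proof -
  have dis: "verts (layer S (i - 1)) \<inter> verts (layer S i) = {}"
    using S i by (auto simp: recursive_coarsening_def)
  have "inj_on (\<lambda>v. {v, super_node S i v}) (verts (layer S (i - 1)))"
    using dis super_node_in_layer[OF S i] by (auto simp: inj_on_def doubleton_eq_iff)
  moreover have "vertical_edges S i = (\<lambda>v. {v, super_node S i v}) ` verts (layer S (i - 1))"
    by (auto simp: vertical_edges_def)
  ultimately show ?thesis by (simp add: card_image)
qed

lemma coarsening_step_simple_graph: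
  assumes "simple_graph F" "coarsening_step F P \<nu> F'"
  shows "simple_graph F'"
proof -
  have "finite P"
    using assms finite_elements by (auto simp: simple_graph_def coarsening_step_def)
  then have "finite (verts F')"
    using assms(2) by (simp add: coarsening_step_def)
  moreover have "\<exists>u\<in>verts F'. \<exists>v\<in>verts F'. u \<noteq> v \<and> e = {u, v}" if "e \<in> edges F'" for e
  proof -
    have "e \<in> {{\<nu> K, \<nu> L} | K L. K \<in> P \<and> L \<in> P \<and> K \<noteq> L \<and>
                             (\<exists>x\<in>K. \<exists>y\<in>L. {x, y} \<in> edges F)}"
      using that assms(2) by (simp only: coarsening_step_def)
    then obtain K L where e: "K \<in> P" "L \<in> P" "K \<noteq> L" "e = {\<nu> K, \<nu> L}"
      by blast
    have P: "inj_on \<nu> P" "verts F' = \<nu> ` P"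
      using assms(2) by (simp_all only: coarsening_step_def)
    have "\<nu> K \<noteq> \<nu> L"
      using e P by (simp add: inj_on_eq_iff)
    then show ?thesis
      unfolding P(2) using e by blast
  qed
  ultimately show ?thesis by (simp add: simple_graph_def)
qed

lemma layer_simple_graph:
  assumes "recursive_coarsening G S" "simple_graph G" "i \<le> depth S"
  shows "simple_graph (layer S i)"
  using assms(3)
proof (induction i)
  case 0
  then show ?case using assms by (simp add: recursive_coarsening_def)
next
  case (Suc i)
  have "coarsening_step (layer S i) (clusters S (Suc i)) (cluster_node S (Suc i)) (layer S (Suc i))"
    using coarsening_step_layer[OF assms(1), of "Suc i"] Suc.prems by simp
  with Suc show ?case using coarsening_step_simple_graph[of "layer S i"] by simp
qed

lemma cum_edge_reduction_eq:
  assumes "num_edges (layer S 0) \<noteq> 0"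
  shows "cum_edge_reduction S i = real (num_edges (layer S i)) / real (num_edges (layer S 0))"
proof -
  have "(\<Prod>j=1..i. edge_reduction S j) = real (num_edges (layer S i)) / real (num_edges (layer S 0))"
    if "\<forall>j\<in>{1..i}. num_edges (layer S (j - 1)) \<noteq> 0"
    using that
  proof (induction i)
    case (Suc i)
    have "num_edges (layer S i) \<noteq> 0"
      using bspec[OF Suc.prems, of "Suc i"] by simp
    with Suc show ?case by (simp add: edge_reduction_def)
  qed (use assms in simp)
  then show ?thesis by (simp add: cum_edge_reduction_def)
qed

lemma layer_verts_nonempty:
  assumes "recursive_coarsening G S" "verts G \<noteq> {}" "i \<le> depth S"
  shows "verts (layer S i) \<noteq> {}"
  using assms(3)
proof (induction i)
  case 0
  then show ?case using assms by (simp add: recursive_coarsening_def)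
next
  case (Suc i)
  have "coarsening_step (layer S i) (clusters S (Suc i)) (cluster_node S (Suc i)) (layer S (Suc i))"
    using coarsening_step_layer[OF assms(1), of "Suc i"] Suc.prems by simp
  then have "partition_on (verts (layer S i)) (clusters S (Suc i))"
    and "verts (layer S (Suc i)) = cluster_node S (Suc i) ` clusters S (Suc i)"
    by (simp_all only: coarsening_step_def)
  with Suc show ?case by (auto simp: partition_on_def)
qed

lemma cum_node_reduction_eq:
  assumes "recursive_coarsening G S" "simple_graph G" "verts G \<noteq> {}" "i \<le> depth S"
  shows "cum_node_reduction S i = real (num_verts (layer S i)) / real (num_verts G)"
proof -
  have pos: "num_verts (layer S j) \<noteq> 0" if "j \<le> depth S" for j
    using layer_verts_nonempty[OF assms(1,3) that] layer_simple_graph[OF assms(1,2) that]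
    by (simp add: simple_graph_def)
  have "layer S 0 = G" using assms(1) by (simp add: recursive_coarsening_def)
  moreover have "cum_node_reduction S i = real (num_verts (layer S i)) / real (num_verts (layer S 0))"
    using assms(4)
  proof (induction i)
    case 0
    then show ?case using pos[of 0] by (simp add: cum_node_reduction_def)
  next
    case (Suc i)
    then show ?case using pos[of i] by (simp add: cum_node_reduction_def node_reduction_def)
  qed
  ultimately show ?thesis by simp
qed

end

theory Submission imports Defs begin

text \<open>Connectedness gives \<open>n \<le> 2 m\<close>, so the preserved average degree is \<open>\<Theta>(q)\<close> with
  \<open>q = m / n\<close>.  With \<open>E\<close> the number of edges per node of the layer, the average degree of the layer
  is \<open>E + 1 / r + t\<close> with \<open>0 \<le> t \<le> 1\<close>.  All summands are nonnegative, hence \<open>1 / r\<close> and \<open>E\<close> are both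
  \<open>O(q)\<close>, and the edge bounds follow from \<open>C / R = E / q\<close>.  If \<open>1 / r = o(q)\<close>, then also
  \<open>t = o(q)\<close> because \<open>t \<le> 1 \<le> 1 / r\<close>, and only \<open>E\<close> can account for the \<open>\<Theta>(q)\<close>.\<close>

text \<open>Blocks are nonempty and pairwise disjoint, so choosing one element from each block is an
  injection of \<open>P\<close> into \<open>A\<close>.\<close>

lemma partition_on_card_le:
  assumes "finite A" "partition_on A P"
  shows "card P \<le> card A"
proof -
  have "inj_on (\<lambda>K. SOME x. x \<in> K) P"
    using assms(2) unfolding partition_on_def disjoint_def inj_on_def
    by (metis Int_iff empty_iff some_in_eq)
  moreover have "(\<lambda>K. SOME x. x \<in> K) ` P \<subseteq> A"
    using assms(2) by (auto simp: partition_on_def) (metis some_in_eq)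
  ultimately show ?thesis
    using assms(1) by (rule card_inj_on_le)
qed

text \<open>This gives \<open>r \<le> 1\<close> for the reduction factor, the source of
  \<open>t \<le> 1 / r\<close>.\<close>

lemma coarsening_step_num_verts_le:
  assumes "simple_graph F" "coarsening_step F P \<nu> F'"
  shows "num_verts F' \<le> num_verts F"
  using assms partition_on_card_le[of "verts F" P]
  by (auto simp: simple_graph_def coarsening_step_def card_image)

lemma simple_graph_finite_edges:
  assumes "simple_graph F"
  shows "finite (edges F)"
  by (rule finite_subset[of _ "Pow (verts F)"])
    (use assms in \<open>auto simp: simple_graph_def\<close>)

text \<open>With a second vertex present, a walk from \<open>v\<close> to it starts with an edge at
  \<open>v\<close>. Hence the edges cover all vertices, and each edge covers only two.\<close>

lemma connected_graph_num_verts_le: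
  assumes "simple_graph F" "connected_graph F" "2 \<le> num_verts F"
  shows "num_verts F \<le> 2 * num_edges F"
proof -
  have "\<exists>e\<in>edges F. v \<in> e" if v: "v \<in> verts F" for v
  proof -
    obtain w where w: "w \<in> verts F" "w \<noteq> v"
      using assms(3) v by (metis card_le_Suc0_iff_eq assms(1) simple_graph_def
          not_less_eq_eq numeral_2_eq_2)
    then have "(v, w) \<in> {(x, y). {x, y} \<in> edges F}\<^sup>*"
      using assms(2) v by (simp add: connected_graph_def)
    then show ?thesis
      using w(2) by (cases rule: converse_rtranclE) auto
  qed
  then have "verts F \<subseteq> \<Union> (edges F)"
    by auto
  moreover have "finite (\<Union> (edges F))"
    using assms(1) by (auto simp: simple_graph_finite_edges simple_graph_def)
  ultimately have "num_verts F \<le> card (\<Union> (edges F))"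
    by (simp add: card_mono)
  also have "\<dots> \<le> sum card (edges F)"
    by (rule card_Union_le_sum_card)
  also have "\<dots> \<le> 2 * num_edges F"
    using sum_bounded_above[of "edges F" card 2] assms(1)
    by (force simp: simple_graph_def mult.commute)
  finally show ?thesis .
qed

theorem theorem4:
  fixes G :: "nat \<Rightarrow> 'a ugraph"
    and S :: "nat \<Rightarrow> 'a hierarchy"
    and i :: "nat \<Rightarrow> nat"
    and n m :: "nat \<Rightarrow> nat"
  assumes simple: "\<And>N. simple_graph (G N)"
    and conn: "\<And>N. connected_graph (G N)"
    and n: "\<And>N. n N = num_verts (G N)"
    and m: "\<And>N. m N = num_edges (G N)"
    and n_ge_2: "\<And>N. 2 \<le> n N"
    and coarsening: "\<And>N. recursive_coarsening (G N) (S N)"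
    and level: "\<And>N. 1 \<le> i N \<and> i N \<le> depth (S N)"
    and degree_preserved:
      "(\<lambda>N. avg_degree (S N) (i N)) \<in> \<Theta>(\<lambda>N. (real (m N) + real (n N)) / real (n N))"
  shows "(\<lambda>N. node_reduction (S N) (i N)) \<in> \<Omega>(\<lambda>N. real (n N) / real (m N)) \<and>
    ((\<lambda>N. node_reduction (S N) (i N)) \<in> \<omega>(\<lambda>N. real (n N) / real (m N)) \<longrightarrow>
       (\<lambda>N. cum_edge_reduction (S N) (i N)) \<in> \<Theta>(\<lambda>N. cum_node_reduction (S N) (i N))) \<and>
    ((\<lambda>N. node_reduction (S N) (i N)) \<in> \<Theta>(\<lambda>N. real (n N) / real (m N)) \<longrightarrow>
       (\<lambda>N. cum_edge_reduction (S N) (i N)) \<in> O(\<lambda>N. cum_node_reduction (S N) (i N)))"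
proof -
  let ?r = "\<lambda>N. node_reduction (S N) (i N)"
  let ?R = "\<lambda>N. cum_node_reduction (S N) (i N)"
  let ?C = "\<lambda>N. cum_edge_reduction (S N) (i N)"
  let ?D = "\<lambda>N. avg_degree (S N) (i N)"
  define q where "q N = real (m N) / real (n N)" for N
  define v where "v N = real (num_verts (layer (S N) (i N)))" for N
  \<comment> \<open>The level is at least 1, so the natural-number subtraction
    \<open>i N - 1\<close> really names the layer below.\<close>
  define w where "w N = real (num_verts (layer (S N) (i N - 1)))" for N
  define u where "u N = real (edges_above (S N) (i N))" for N
  define E where "E N = real (num_edges (layer (S N) (i N))) / v N" for N

  have n_pos: "n N > 0" for N
    using n_ge_2[of N] by simp
  have n_le: "real (n N) \<le> 2 * real (m N)" for N
    using connected_graph_num_verts_le[OF simple conn, of N] n_ge_2[of N] n[of N] m[of N]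
    by linarith
  have m_pos: "m N > 0" for N
    using n_le[of N] n_pos[of N] by (cases "m N = 0") auto
  have q_pos: "q N > 0" for N
    using m_pos n_pos by (simp add: q_def)
  have v_pos: "v N > 0" for N
  proof -
    have "verts (layer (S N) (i N)) \<noteq> {}"
      using layer_verts_nonempty[OF coarsening, of N] conn[of N] level[of N]
      by (simp add: connected_graph_def)
    moreover have "finite (verts (layer (S N) (i N)))"
      using layer_simple_graph[OF coarsening simple, of "i N" N] level[of N]
      by (simp add: simple_graph_def)
    ultimately show ?thesis
      by (simp add: v_def card_gt_0_iff)
  qed
  have v_le: "v N \<le> w N" for N
  proof -
    have "simple_graph (layer (S N) (i N - 1))"
      using layer_simple_graph[OF coarsening simple, of "i N - 1" N] level[of N] by linarith
    moreover have "coarsening_step (layer (S N) (i N - 1)) (clusters (S N) (i N))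
        (cluster_node (S N) (i N)) (layer (S N) (i N))"
      using coarsening_step_layer[OF coarsening] level by blast
    ultimately show ?thesis
      using coarsening_step_num_verts_le by (fastforce simp: v_def w_def)
  qed
  have u: "0 \<le> u N" "u N \<le> v N" for N
    by (auto simp: u_def v_def edges_above_def)
  have r: "?r N = v N / w N" for N
    by (simp add: node_reduction_def v_def w_def)
  have r_pos: "?r N > 0" and r_le: "?r N \<le> 1" for N
    using v_pos[of N] v_le[of N] by (auto simp: r)
  have E_nonneg: "E N \<ge> 0" for N
    using v_pos[of N] by (simp add: E_def)
  \<comment> \<open>Here \<open>w N / v N\<close> is the inverse of the reduction factor, and
    \<open>u N / v N\<close> is the \<open>t\<close> of the overview.\<close>
  have D: "?D N = E N + (inverse (?r N) + u N / v N)" for N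
    by (simp add: avg_degree_def E_def r add_divide_distrib u_def v_def w_def)
  \<comment> \<open>As \<open>m N > 0\<close>, the cumulative edge reduction is the plain quotient
    by \<open>m N\<close>, even if an intermediate layer has lost all its edges. Then
    \<open>v N\<close> cancels.\<close>
  have C: "?C N = ?R N * (E N / q N)" for N
  proof -
    have "layer (S N) 0 = G N"
      using coarsening[of N] by (simp add: recursive_coarsening_def)
    then have "?C N = real (num_edges (layer (S N) (i N))) / real (m N)"
      using cum_edge_reduction_eq[of "S N" "i N"] m_pos[of N] by (simp add: m)
    moreover have "?R N = v N / real (n N)"
      using cum_node_reduction_eq[OF coarsening simple, of N "i N"] conn[of N] level[of N]
      by (simp add: connected_graph_def v_def n)
    ultimately show ?thesis
      using v_pos[of N] n_pos[of N] m_pos[of N] by (simp add: E_def q_def)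
  qed
  have inv_q: "(\<lambda>N. real (n N) / real (m N)) = (\<lambda>N. inverse (q N))"
    by (simp add: q_def)

  \<comment> \<open>The constant 3 comes from \<open>n N \<le> 2 * m N\<close>, which gives
    \<open>m N + n N \<le> 3 * m N\<close>.\<close>
  have "(real (m N) + real (n N)) / real (n N) \<le> 3 * q N" for N
  proof -
    have "(real (m N) + real (n N)) / real (n N) \<le> (3 * real (m N)) / real (n N)"
      using n_le[of N] by (intro divide_right_mono) auto
    then show ?thesis
      by (simp add: q_def)
  qed
  then have "(\<lambda>N. (real (m N) + real (n N)) / real (n N)) \<in> O(q)"
    using q_pos by (intro bigoI[of _ 3] always_eventually) (simp add: less_imp_le)
  moreover have "q \<in> O(\<lambda>N. (real (m N) + real (n N)) / real (n N))"
    by (intro landau_o.big_mono always_eventually) (auto simp: q_def divide_right_mono)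
  ultimately have "(\<lambda>N. (real (m N) + real (n N)) / real (n N)) \<in> \<Theta>(q)"
    by (simp add: bigthetaI bigomega_iff_bigo)
  then have D_theta: "?D \<in> \<Theta>(q)"
    using degree_preserved landau_theta.trans by blast
  then have D_bigo: "?D \<in> O(q)"
    by (rule bigthetaD1)

  have inv_r_bigo: "(\<lambda>N. inverse (?r N)) \<in> O(q)"
  proof (rule landau_o.big_trans[OF _ D_bigo], rule landau_o.big_mono, rule always_eventually, rule allI)
    fix N
    show "norm (inverse (?r N)) \<le> norm (?D N)"
      using D[of N] E_nonneg[of N] r_pos[of N] u(1)[of N] v_pos[of N] by simp
  qed
  have E_bigo: "E \<in> O(q)"
  proof (rule landau_o.big_trans[OF _ D_bigo], rule landau_o.big_mono, rule always_eventually, rule allI)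
    fix N
    show "norm (E N) \<le> norm (?D N)"
      using D[of N] E_nonneg[of N] r_pos[of N] u(1)[of N] v_pos[of N] by simp
  qed

  \<comment> \<open>Both functions are positive, so taking inverses reverses the bound
    \<open>1 / r = O(q)\<close> into \<open>1 / q = O(r)\<close>.\<close>
  have 1: "?r \<in> \<Omega>(\<lambda>N. inverse (q N))"
    using landau_o.big.inverse[OF _ _ inv_r_bigo] r_pos q_pos
    by (simp add: bigomega_iff_bigo less_imp_neq[THEN not_sym])

  have "(\<lambda>N. E N / q N) \<in> O(\<lambda>N. 1)"
    using landau_o.big.divide_right[of q sequentially E q] E_bigo q_pos
    by (simp add: less_imp_neq[THEN not_sym])
  from landau_o.big.mult_left[OF this, of ?R] have 2: "?C \<in> O(?R)"
    unfolding C mult_1_right .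

  have 3: "?C \<in> \<Theta>(?R)" if "?r \<in> \<omega>(\<lambda>N. inverse (q N))"
  proof -
    \<comment> \<open>Inverting \<open>1 / q = o(r)\<close> gives
      \<open>1 / r = o(q)\<close>.\<close>
    have inv_r: "(\<lambda>N. inverse (?r N)) \<in> o(q)"
      using that landau_o.small.inverse[of "\<lambda>N. inverse (q N)" sequentially ?r] r_pos q_pos
      by (simp add: smallomega_iff_smallo less_imp_neq[THEN not_sym])
    have "(\<lambda>N. u N / v N) \<in> O(\<lambda>N. inverse (?r N))"
    proof (rule landau_o.big_mono, rule always_eventually, rule allI)
      fix N
      have "0 \<le> u N / v N" "u N / v N \<le> 1" "1 \<le> inverse (?r N)"
        using u[of N] v_pos[of N] r_pos[of N] r_le[of N] by (auto simp: one_le_inverse)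
      then show "norm (u N / v N) \<le> norm (inverse (?r N))"
        unfolding real_norm_def by linarith
    qed
    then have "(\<lambda>N. u N / v N) \<in> o(q)"
      using inv_r landau_o.big_small_trans by blast
    with inv_r have "(\<lambda>N. inverse (?r N) + u N / v N) \<in> o(q)"
      by (rule sum_in_smallo)
    \<comment> \<open>Because \<open>?D\<close> and \<open>q\<close> have the same order,
      \<open>o(q)\<close> may be replaced by \<open>o(?D)\<close>. Then \<open>E\<close> is
      \<open>?D\<close> minus a term negligible against \<open>?D\<close>, and so keeps the order of
      \<open>?D\<close>.\<close>
    then have "(\<lambda>N. inverse (?r N) + u N / v N) \<in> o(?D)"
      using landau_o.small.cong_bigtheta[OF D_theta] by simp
    moreover have "E = (\<lambda>N. ?D N - (inverse (?r N) + u N / v N))"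
      by (simp add: D)
    ultimately have "\<Theta>(E) = \<Theta>(?D)"
      by (simp only: landau_theta.diff_absorb2)
    then have "E \<in> \<Theta>(?D)"
      using bigtheta_refl by blast
    then have "E \<in> \<Theta>(q)"
      using D_theta landau_theta.trans by blast
    then have "(\<lambda>N. E N / q N) \<in> \<Theta>(\<lambda>N. 1)"
      using landau_theta.divide_right[of q sequentially E q] q_pos
      by (simp add: less_imp_neq[THEN not_sym])
    \<comment> \<open>Multiplying \<open>E / q = \<Theta>(1)\<close> by \<open>?R\<close> turns the
      left side into \<open>?C\<close>, by the identity \<open>C\<close>.\<close>
    from landau_theta.mult_left[OF this, of ?R] show ?thesis
      unfolding C mult_1_right .
  qed

  show ?thesis
    unfolding inv_q using 1 2 3 by blast
qed

end
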